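(* Let $r\ge 1$ be an integer. Then, for all sufficiently large $n$, \[ \hat{R}(P_n,r) \ge \frac{(r+3)r}{4}n-\frac{r(5r+11)}{4}+3. \]
   Context: $P_n$ denotes the path on $n$ vertices. For graphs $G,F$ and $r\in\mathbb{N}$, $G\to(F)_r$ means that every colouring of the edges of $G$ with $r$ colours contains a monochromatic copy of $F$. The size-Ramsey number is $\hat{R}(F,r)=\min\{|E(G)| : G\to(F)_r\}$. *)

theory Defs
  imports Complex_Main
begin

record 'a graph =
  verts :: "'a set"
  edges :: "'a set set"

definition finite_simple_graph :: "'a graph \<Rightarrow> bool" where
  "finite_simple_graph G \<longleftrightarrow>
     finite (verts G) \<and> (\<forall>e\<in>edges G. e \<subseteq> verts G \<and> card e = 2)"

definition path_graph :: "nat \<Rightarrow> nat graph" where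
  "path_graph n = \<lparr>verts = {..<n}, edges = {{i, Suc i} | i. Suc i < n}\<rparr>"

lemma finite_simple_graph_path_graph: "finite_simple_graph (path_graph n)"
  by (auto simp: finite_simple_graph_def path_graph_def)

(* A copy is a subgraph isomorphic to F, not necessarily an induced one. *)
definition contains_copy :: "'a graph \<Rightarrow> 'b graph \<Rightarrow> bool" where
  "contains_copy G F \<longleftrightarrow>
     (\<exists>f. inj_on f (verts F) \<and> f ` verts F \<subseteq> verts G \<and> (\<forall>e\<in>edges F. f ` e \<in> edges G))"

definition colour_class :: "'a graph \<Rightarrow> ('a set \<Rightarrow> nat) \<Rightarrow> nat \<Rightarrow> 'a graph" where
  "colour_class G c k = \<lparr>verts = verts G, edges = {e \<in> edges G. c e = k}\<rparr>"

definition ramsey_arrow :: "'a graph \<Rightarrow> 'b graph \<Rightarrow> nat \<Rightarrow> bool" where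
  "ramsey_arrow G F r \<longleftrightarrow>
     (\<forall>c. c ` edges G \<subseteq> {..<r} \<longrightarrow> (\<exists>k<r. contains_copy (colour_class G c k) F))"

(* Every finite graph is isomorphic to one with vertices in nat, so ranging over
   these G loses nothing. For r \<ge> 1 and F finite and simple, the minimum is
   attained because some such G exists by Ramsey's theorem. *)
definition size_ramsey :: "'b graph \<Rightarrow> nat \<Rightarrow> nat" where
  "size_ramsey F r =
     (LEAST m. \<exists>G :: nat graph. finite_simple_graph G \<and> ramsey_arrow G F r \<and> card (edges G) = m)"

end

theory Submission
  imports Defs "HOL-Library.Ramsey"
begin

text \<open>
  Induction from \<open>r\<close> to \<open>r + 1\<close> colours. From a graph with too few edges, repeatedly delete a vertex of
  degree at least \<open>r + 2\<close>. If \<open>\<lfloor>n/2\<rfloor> - 1\<close> vertices can be deleted, the edges at them contain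
  no \<open>P\<^sub>n\<close> and form one colour class, and what remains is handled with \<open>r\<close> colours.
  If the process stops earlier, the remaining graph has maximum degree at most \<open>r + 1\<close>. Deleting a
  minimal edge cover, which is a star forest, lowers the maximum degree, so \<open>r - 1\<close> star forests
  reduce it to 2. A graph of maximum degree 2 loses all its copies of \<open>P\<^sub>n\<close> when a bounded number
  of edges is removed. These join the first star forest or, if \<open>r = 1\<close>, the edges at the deleted
  vertices.
\<close>

section \<open>Paths and colourings of edge sets\<close>

text \<open>Graphs are reduced to their edge sets, so that deletions and unions of colour classes
  are plain set operations.\<close>

definition has_path :: "'a set set \<Rightarrow> nat \<Rightarrow> bool" where
  "has_path E n \<longleftrightarrow> (\<exists>f. inj_on f {..<n} \<and> (\<forall>i. Suc i < n \<longrightarrow> {f i, f (Suc i)} \<in> E))"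

definition colourable :: "'a set set \<Rightarrow> nat \<Rightarrow> nat \<Rightarrow> bool" where
  "colourable E n r \<longleftrightarrow> (\<exists>c. c ` E \<subseteq> {..<r} \<and> (\<forall>k<r. \<not> has_path {e \<in> E. c e = k} n))"

definition degree :: "'a set set \<Rightarrow> 'a \<Rightarrow> nat" where
  "degree E v = card {e \<in> E. v \<in> e}"

lemma has_path_mono: "has_path E n \<Longrightarrow> E \<subseteq> F \<Longrightarrow> has_path F n"
  unfolding has_path_def by blast

lemma degree_mono: "finite F \<Longrightarrow> E \<subseteq> F \<Longrightarrow> degree E v \<le> degree F v"
  unfolding degree_def by (intro card_mono) auto

lemma colourable_one: "\<not> has_path E n \<Longrightarrow> colourable E n 1"
  unfolding colourable_def by (intro exI[of _ "\<lambda>_. 0"]) auto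

lemma colourable_Suc:
  assumes F: "\<not> has_path F n" and E': "colourable E' n r" and E: "E \<subseteq> E' \<union> F"
  shows "colourable E n (Suc r)"
proof -
  obtain c where c: "c ` E' \<subseteq> {..<r}" "\<And>k. k < r \<Longrightarrow> \<not> has_path {e \<in> E'. c e = k} n"
    using E' unfolding colourable_def by blast
  define c' where "c' e = (if e \<in> E' then c e else r)" for e
  have "c' ` E \<subseteq> {..<Suc r}" using c(1) by (auto simp: c'_def less_Suc_eq)
  moreover have "\<not> has_path {e \<in> E. c' e = k} n" if "k < Suc r" for k
  proof (cases "k = r")
    case True
    have "{e \<in> E. c' e = k} \<subseteq> F" using True c(1) E by (auto simp: c'_def)
    then show ?thesis using F has_path_mono by blast
  next
    case False
    then have "k < r" using that by simp
    moreover have "{e \<in> E. c' e = k} \<subseteq> {e \<in> E'. c e = k}"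
      using False by (auto simp: c'_def split: if_splits)
    ultimately show ?thesis using c(2) has_path_mono by blast
  qed
  ultimately show ?thesis unfolding colourable_def by blast
qed

lemma path_edge_eq_iff:
  assumes "inj_on f {..<n}" "Suc i < n" "Suc j < n"
  shows "{f i, f (Suc i)} = {f j, f (Suc j)} \<longleftrightarrow> i = j"
proof
  assume "{f i, f (Suc i)} = {f j, f (Suc j)}"
  then have "f i = f j \<or> (f i = f (Suc j) \<and> f (Suc i) = f j)" by (auto simp: doubleton_eq_iff)
  moreover have "f a = f b \<longleftrightarrow> a = b" if "a < n" "b < n" for a b
    using inj_on_eq_iff[OF assms(1)] that by auto
  ultimately show "i = j" using assms(2,3) by auto
qed simp

section \<open>Vertex covers of paths and greedy vertex deletion\<close>

text \<open>Of the \<open>n - 1\<close> path edges, each vertex of \<open>S\<close> lies on at most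
  two and each element of \<open>B\<close> equals at most one.\<close>

lemma path_length_le_vertex_cover:
  assumes "has_path E n" and S: "finite S" and B: "finite B"
    and cover: "\<And>e. e \<in> E \<Longrightarrow> e \<inter> S \<noteq> {} \<or> e \<in> B"
  shows "n \<le> 2 * card S + 1 + card B"
proof -
  obtain f where inj: "inj_on f {..<n}" and E: "\<And>i. Suc i < n \<Longrightarrow> {f i, f (Suc i)} \<in> E"
    using assms(1) unfolding has_path_def by blast
  define ed where "ed i = {f i, f (Suc i)}" for i
  define I where "I = {i. i < n - 1 \<and> ed i \<in> B}"
  define J where "J s = {i. i < n - 1 \<and> s \<in> ed i}" for s
  have "inj_on ed {..<n-1}"
    unfolding inj_on_def ed_def using path_edge_eq_iff[OF inj] by auto
  then have "inj_on ed I" by (rule inj_on_subset) (auto simp: I_def)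
  then have "card I \<le> card B" by (rule card_inj_on_le) (auto simp: I_def B)
  have J: "card (J s) \<le> 2" for s
  proof -
    have "card {i. i < n \<and> f i = s} \<le> Suc 0"
      using inj by (subst card_le_Suc0_iff_eq) (auto simp: inj_on_def)
    moreover have "card {i. i < n - 1 \<and> f (Suc i) = s} \<le> Suc 0"
    proof (subst card_le_Suc0_iff_eq, simp, intro ballI)
      fix a b assume "a \<in> {i. i < n - 1 \<and> f (Suc i) = s}" "b \<in> {i. i < n - 1 \<and> f (Suc i) = s}"
      then have "f (Suc a) = f (Suc b)" "Suc a < n" "Suc b < n" by (simp_all, linarith+)
      then show "a = b" using inj_onD[OF inj, of "Suc a" "Suc b"] by simp
    qed
    moreover have "card (J s) \<le> card ({i. i < n \<and> f i = s} \<union> {i. i < n - 1 \<and> f (Suc i) = s})"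
      by (intro card_mono) (auto simp: J_def ed_def)
    moreover note card_Un_le[of "{i. i < n \<and> f i = s}" "{i. i < n - 1 \<and> f (Suc i) = s}"]
    ultimately show ?thesis by linarith
  qed
  have "{..<n-1} \<subseteq> I \<union> (\<Union>s\<in>S. J s)"
  proof
    fix i assume "i \<in> {..<n-1}"
    then have "ed i \<in> E" using E[of i] by (simp add: ed_def)
    from cover[OF this] \<open>i \<in> {..<n-1}\<close> show "i \<in> I \<union> (\<Union>s\<in>S. J s)"
      by (auto simp: I_def J_def)
  qed
  then have "card {..<n-1} \<le> card (I \<union> (\<Union>s\<in>S. J s))"
    by (intro card_mono) (auto simp: I_def J_def S)
  also have "\<dots> \<le> card I + card (\<Union>s\<in>S. J s)" by (rule card_Un_le)
  also have "card (\<Union>s\<in>S. J s) \<le> (\<Sum>s\<in>S. card (J s))" using S by (rule card_UN_le)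
  also have "\<dots> \<le> (\<Sum>s\<in>S. 2)" by (intro sum_mono J)
  finally show ?thesis using \<open>card I \<le> card B\<close> by simp
qed

text \<open>Induction on the budget \<open>k\<close>: every newly deleted vertex accounts for at
  least \<open>d\<close> edges of its own, and the process stops early only when all degrees are
  below \<open>d\<close>.\<close>

lemma greedy_deletion:
  assumes "finite E" "0 < d"
  shows "\<exists>S. finite S \<and> card S \<le> k \<and>
    card {e \<in> E. e \<inter> S = {}} + d * card S \<le> card E \<and>
    (card S = k \<or> (\<forall>v. degree {e \<in> E. e \<inter> S = {}} v < d))"
proof (induction k)
  case 0
  show ?case by (intro exI[of _ "{}"]) auto
next
  case (Suc k)
  then obtain S where S: "finite S" "card S \<le> k"
    "card {e \<in> E. e \<inter> S = {}} + d * card S \<le> card E"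
    "card S = k \<or> (\<forall>v. degree {e \<in> E. e \<inter> S = {}} v < d)" by blast
  let ?H = "{e \<in> E. e \<inter> S = {}}"
  show ?case
  proof (cases "\<forall>v. degree ?H v < d")
    case True
    then show ?thesis using S by (intro exI[of _ S]) auto
  next
    case False
    then obtain v where v: "degree ?H v \<ge> d" by (auto simp: not_less)
    have "v \<notin> S"
    proof
      assume "v \<in> S"
      then have "{e \<in> ?H. v \<in> e} = {}" by auto
      then show False using v \<open>0 < d\<close> unfolding degree_def by (metis card.empty not_le)
    qed
    let ?H' = "{e \<in> E. e \<inter> insert v S = {}}"
    have "card ?H = card (?H' \<union> {e \<in> ?H. v \<in> e})" by (rule arg_cong[of _ _ card]) auto
    also have "card (?H' \<union> {e \<in> ?H. v \<in> e}) = card ?H' + degree ?H v"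
      unfolding degree_def using assms by (intro card_Un_disjoint) auto
    finally have "card ?H = card ?H' + degree ?H v" .
    moreover have "d * card (insert v S) = d * card S + d" using S(1) \<open>v \<notin> S\<close> by simp
    ultimately have "card ?H' + d * card (insert v S) \<le> card E" using S(3) v by linarith
    moreover have "card S = k" using S(4) v by (auto simp: not_less[symmetric])
    ultimately show ?thesis using S \<open>v \<notin> S\<close> by (intro exI[of _ "insert v S"]) auto
  qed
qed

section \<open>Star forests from minimal edge covers\<close>

text \<open>In an inclusion-minimal edge cover each edge has a private vertex, on no other edge of
  the cover, since otherwise it could be dropped. In a simple graph such a vertex is a leaf, which
  makes the cover a star forest.\<close>

lemma star_forest_cover:
  assumes "finite E"
  shows "\<exists>F\<subseteq>E. \<Union>F = \<Union>E \<and> (\<forall>e\<in>F. \<exists>v\<in>e. \<forall>e'\<in>F. v \<in> e' \<longrightarrow> e' = e)"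
proof -
  define C where "C = {F. F \<subseteq> E \<and> \<Union>F = \<Union>E}"
  have "finite C" "E \<in> C" using assms by (simp_all add: C_def)
  then have "\<exists>F\<in>C. F \<subseteq> E \<and> (\<forall>F'\<in>C. F' \<subseteq> F \<longrightarrow> F = F')"
    by (rule finite_has_minimal2)
  then obtain F where "F \<in> C" and min: "\<forall>F'\<in>C. F' \<subseteq> F \<longrightarrow> F = F'" by blast
  then have F: "F \<subseteq> E" "\<Union>F = \<Union>E" by (simp_all add: C_def)
  have "\<exists>v\<in>e. \<forall>e'\<in>F. v \<in> e' \<longrightarrow> e' = e" if "e \<in> F" for e
  proof (rule ccontr)
    assume "\<not> (\<exists>v\<in>e. \<forall>e'\<in>F. v \<in> e' \<longrightarrow> e' = e)"
    then have "e \<subseteq> \<Union>(F - {e})" by blast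
    then have "\<Union>(F - {e}) = \<Union>F" using that by blast
    then have "F - {e} \<in> C" using F by (auto simp: C_def)
    then have "F = F - {e}" using min by (meson Diff_subset)
    then show False using that by blast
  qed
  then show ?thesis using F by blast
qed

text \<open>The cover \<open>F\<close> has an edge at each non-isolated vertex, so removing it
  lowers every positive degree.\<close>

lemma degree_Diff_cover:
  assumes "finite E" "F \<subseteq> E" "\<Union>F = \<Union>E" "degree E v \<le> Suc d"
  shows "degree (E - F) v \<le> d"
proof (cases "v \<in> \<Union>E")
  case True
  then obtain e where e: "e \<in> F" "v \<in> e" using assms(3) by blast
  then have "card {e \<in> E - F. v \<in> e} < card {e \<in> E. v \<in> e}"
    using assms by (intro psubset_card_mono) auto
  then show ?thesis using assms(4) unfolding degree_def by simp
next
  case False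
  then have "{e \<in> E - F. v \<in> e} = {}" by blast
  then show ?thesis unfolding degree_def by (metis card.empty le0)
qed

text \<open>Of any three consecutive edges of a path, at least one is outside a star forest.\<close>

lemma path_length_le_star_forest:
  assumes "has_path (F \<union> B) n" and B: "finite B"
    and star: "\<And>e. e \<in> F \<Longrightarrow> \<exists>v\<in>e. \<forall>e'\<in>F. v \<in> e' \<longrightarrow> e' = e"
  shows "n \<le> 3 * card B + 3"
proof (rule ccontr)
  assume n: "\<not> n \<le> 3 * card B + 3"
  obtain f where inj: "inj_on f {..<n}" and E: "\<And>i. Suc i < n \<Longrightarrow> {f i, f (Suc i)} \<in> F \<union> B"
    using assms(1) unfolding has_path_def by blast
  define ed where "ed i = {f i, f (Suc i)}" for i
  have ed_eq: "ed i = ed j \<longleftrightarrow> i = j" if "Suc i < n" "Suc j < n" for i j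
    unfolding ed_def using path_edge_eq_iff[OF inj that] .
  \<comment> \<open>The path edges are cut into blocks of three, numbered by \<open>m\<close>. Each
    of the first \<open>card B + 1\<close> blocks contains an edge of \<open>B\<close>, which is one
    edge too many.\<close>
  have "\<exists>i. i div 3 = m \<and> Suc i < n \<and> ed i \<in> B" if m: "m \<le> card B" for m
  proof (rule ccontr)
    assume *: "\<nexists>i. i div 3 = m \<and> Suc i < n \<and> ed i \<in> B"
    have in_F: "ed i \<in> F" if "i div 3 = m" "Suc i < n" for i
      using * E[of i] that by (auto simp: ed_def)
    let ?i = "3 * m"
    have lt: "Suc (Suc (Suc ?i)) < n" using m n by linarith
    have F: "ed ?i \<in> F" "ed (Suc ?i) \<in> F" "ed (Suc (Suc ?i)) \<in> F"
      using lt by (auto intro!: in_F)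
    obtain v where v: "v \<in> ed (Suc ?i)" "\<And>e'. e' \<in> F \<Longrightarrow> v \<in> e' \<Longrightarrow> e' = ed (Suc ?i)"
      using star[OF F(2)] by blast
    \<comment> \<open>Both vertices of the middle edge are shared with a neighbouring edge, so
      neither can be private.\<close>
    have "v \<in> ed ?i \<or> v \<in> ed (Suc (Suc ?i))" using v(1) by (auto simp: ed_def)
    then have "ed ?i = ed (Suc ?i) \<or> ed (Suc (Suc ?i)) = ed (Suc ?i)" using v(2) F by blast
    then show False using ed_eq[of ?i "Suc ?i"] ed_eq[of "Suc (Suc ?i)" "Suc ?i"] lt by auto
  qed
  then obtain h where h: "\<And>m. m \<le> card B \<Longrightarrow> h m div 3 = m \<and> Suc (h m) < n \<and> ed (h m) \<in> B"
    by metis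
  have "inj_on (\<lambda>m. ed (h m)) {..card B}"
  proof (rule inj_onI)
    fix a b assume "a \<in> {..card B}" "b \<in> {..card B}" and eq: "ed (h a) = ed (h b)"
    then have "a \<le> card B" "b \<le> card B" by simp_all
    note hab = this[THEN h]
    then have "h a = h b" using ed_eq eq by blast
    then show "a = b" using hab by metis
  qed
  then have "card {..card B} \<le> card B"
    using B h by (intro card_inj_on_le) auto
  then show False by simp
qed

section \<open>Breaking paths in graphs of maximum degree two\<close>

text \<open>Removing the first and the last edge of a copy of \<open>P\<^sub>n\<close> isolates the \<open>n - 2\<close> vertices
  between them, because these have degree 2.\<close>

lemma break_paths:
  assumes "finite E" "\<And>v. degree E v \<le> 2" and n: "3 \<le> n"
  shows "\<exists>B\<subseteq>E. card B * (n - 1) \<le> 2 * card E \<and> \<not> has_path (E - B) n"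
  using assms(1,2)
proof (induction "card E" arbitrary: E rule: less_induct)
  case less
  show ?case
  proof (cases "has_path E n")
    case False
    then show ?thesis by (intro exI[of _ "{}"]) auto
  next
    case True
    then obtain f where inj: "inj_on f {..<n}" and E: "\<And>i. Suc i < n \<Longrightarrow> {f i, f (Suc i)} \<in> E"
      unfolding has_path_def by blast
    define ed where "ed i = {f i, f (Suc i)}" for i
    have ed_eq: "ed i = ed j \<longleftrightarrow> i = j" if "Suc i < n" "Suc j < n" for i j
      unfolding ed_def using path_edge_eq_iff[OF inj that] .
    have ed_E: "ed i \<in> E" if "Suc i < n" for i using E[OF that] by (simp add: ed_def)
    define P where "P = ed ` {..<n-1}"
    have "inj_on ed {..<n-1}" using ed_eq by (auto simp: inj_on_def)
    then have card_P: "card P = n - 1" unfolding P_def by (simp add: card_image)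
    have P_E: "P \<subseteq> E" using ed_E by (auto simp: P_def)
    have card_E: "card E = card (E - P) + (n - 1)"
      using card_P card_Diff_subset[OF finite_subset[OF P_E less.prems(1)] P_E]
        card_mono[OF less.prems(1) P_E] by simp
    then have "card (E - P) < card E" using n by simp
    moreover have "degree (E - P) v \<le> 2" for v
      using degree_mono[OF less.prems(1), of "E - P" v] less.prems(2)[of v] by auto
    ultimately obtain B' where B': "B' \<subseteq> E - P" "card B' * (n - 1) \<le> 2 * card (E - P)"
      "\<not> has_path (E - P - B') n"
      using less.hyps[of "E - P"] less.prems(1) by blast
    \<comment> \<open>Two edges are spent on a path of \<open>n - 1\<close> edges, hence the ratio
      in the bound on \<open>card B\<close>.\<close>
    define B where "B = B' \<union> {ed 0, ed (n - 2)}"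
    have B_E: "B \<subseteq> E" using B'(1) ed_E n by (auto simp: B_def)
    have "card B \<le> card B' + 2"
      unfolding B_def by (rule order_trans[OF card_Un_le]) (simp add: card_insert_if)
    then have "card B * (n - 1) \<le> (card B' + 2) * (n - 1)" by (rule mult_right_mono) simp
    then have "card B * (n - 1) \<le> 2 * card E" using B'(2) card_E by (simp add: algebra_simps)
    moreover have "\<not> has_path (E - B) n"
    proof
      assume "has_path (E - B) n"
      then obtain g where g: "inj_on g {..<n}"
        and g_E: "\<And>i. Suc i < n \<Longrightarrow> {g i, g (Suc i)} \<in> E - B"
        unfolding has_path_def by blast
      \<comment> \<open>The inner vertices of the removed path. Every edge of \<open>E - B\<close>
        lies inside \<open>V\<close> or avoids it, so the path \<open>g\<close> stays on one
        side.\<close>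
      define V where "V = f ` {0<..<n-1}"
      have inside: "e \<subseteq> V" if "e \<in> P" "e \<notin> B" for e
      proof -
        from that(1) obtain i where "e = ed i" "i \<in> {..<n-1}" unfolding P_def by (rule imageE)
        then have i: "i < n - 1" "e = ed i" by simp_all
        then have "i \<noteq> 0" "i \<noteq> n - 2" using that(2) by (auto simp: B_def)
        then show ?thesis using i by (auto simp: V_def ed_def)
      qed
      have outside: "e \<inter> V = {}" if "e \<in> E - P" for e
      proof (rule ccontr)
        assume "e \<inter> V \<noteq> {}"
        then obtain v where v: "v \<in> e" "v \<in> V" by blast
        from v(2) obtain i where "v = f i" "i \<in> {0<..<n-1}" unfolding V_def by (rule imageE)
        then have i: "0 < i" "i < n - 1" "f i \<in> e" using v(1) by simp_all
        define j where "j = i - 1"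
        have j: "i = Suc j" using i by (simp add: j_def)
        have "ed j \<in> P" "ed i \<in> P" using i j by (auto simp: P_def)
        then have "{e, ed j, ed i} \<subseteq> {e \<in> E. f i \<in> e}" "e \<noteq> ed j" "e \<noteq> ed i"
          using that P_E i(3) j by (auto simp: ed_def)
        moreover have "ed j \<noteq> ed i" using ed_eq[of j i] i j by auto
        ultimately have "3 \<le> card {e \<in> E. f i \<in> e}"
          using card_mono[of "{e \<in> E. f i \<in> e}" "{e, ed j, ed i}"] less.prems(1) by simp
        then show False using less.prems(2)[of "f i"] by (simp add: degree_def)
      qed
      have step: "g i \<in> V \<longleftrightarrow> g (Suc i) \<in> V" if "Suc i < n" for i
        using g_E[OF that] inside[of "{g i, g (Suc i)}"] outside[of "{g i, g (Suc i)}"]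
        by (cases "{g i, g (Suc i)} \<in> P") auto
      have const: "g i \<in> V \<longleftrightarrow> g 0 \<in> V" if "i < n" for i
        using that by (induction i) (use step in auto)
      show False
      \<comment> \<open>\<open>V\<close> has too few vertices to hold \<open>g\<close>; outside
        \<open>V\<close>, \<open>g\<close> would be a path excluded by the induction
        hypothesis.\<close>
      proof (cases "g 0 \<in> V")
        case True
        then have "g ` {..<n} \<subseteq> V" using const by auto
        then have "card {..<n} \<le> card V" by (intro card_inj_on_le[OF g]) (auto simp: V_def)
        also have "\<dots> \<le> card {0<..<n-1}" unfolding V_def by (intro card_image_le) simp
        finally show False using n by simp
      next
        case False
        have "{g i, g (Suc i)} \<in> E - P - B'" if "Suc i < n" for i
        proof -
          have "g i \<notin> V" using const[of i] False that by simp
          then show ?thesis using g_E[OF that] inside[of "{g i, g (Suc i)}"] by (auto simp: B_def)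
        qed
        then show False using B'(3) g unfolding has_path_def by blast
      qed
    qed
    ultimately show ?thesis using B_E by blast
  qed
qed

section \<open>Remainders of bounded degree\<close>

text \<open>Each induction step spends one colour on a star forest and lowers the degree bound by
  one. In the base case, degree 3 with two colours, one class is a star forest together with the
  edges \<open>B\<close> that break the paths of the rest. The size hypothesis gives
  \<open>3 * card B + 3 < n\<close>, so this class has no path either.\<close>

lemma colourable_bounded_degree:
  assumes "finite E" "\<And>v. degree E v \<le> d + 3" "6 * card E < (n - 3) * (n - 1)"
  shows "colourable E n (d + 2)"
  using assms
proof (induction d arbitrary: E)
  case 0
  \<comment> \<open>For \<open>n \<le> 3\<close> truncated subtraction would make the right-hand
    side of the size hypothesis 0.\<close>
  have n: "3 < n" using 0(3) by (cases "n \<le> 3") auto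
  obtain F where F: "F \<subseteq> E" "\<Union>F = \<Union>E" "\<forall>e\<in>F. \<exists>v\<in>e. \<forall>e'\<in>F. v \<in> e' \<longrightarrow> e' = e"
    using star_forest_cover[OF 0(1)] by blast
  have "degree (E - F) v \<le> 2" for v
    using degree_Diff_cover[OF 0(1) F(1,2), of v 2] 0(2)[of v] by simp
  then obtain B where B: "B \<subseteq> E - F" "card B * (n - 1) \<le> 2 * card (E - F)"
    "\<not> has_path (E - F - B) n"
    using break_paths[of "E - F" n] 0(1) n by auto
  have "card (E - F) \<le> card E" using 0(1) by (intro card_mono) auto
  then have "(3 * card B) * (n - 1) < (n - 3) * (n - 1)" using B(2) 0(3) by linarith
  then have "3 * card B < n - 3" by simp
  moreover have "finite B" using B(1) 0(1) by (meson finite_Diff finite_subset)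
  ultimately have "\<not> has_path (F \<union> B) n"
    using path_length_le_star_forest[of F B n] F(3) by auto
  then have "colourable E n (Suc 1)"
    by (rule colourable_Suc[OF _ colourable_one[OF B(3)]]) auto
  then show ?case by (simp add: numeral_2_eq_2)
next
  case (Suc d)
  have n: "3 < n" using Suc.prems(3) by (cases "n \<le> 3") auto
  obtain F where F: "F \<subseteq> E" "\<Union>F = \<Union>E" "\<forall>e\<in>F. \<exists>v\<in>e. \<forall>e'\<in>F. v \<in> e' \<longrightarrow> e' = e"
    using star_forest_cover[OF Suc.prems(1)] by blast
  have "degree (E - F) v \<le> d + 3" for v
    using degree_Diff_cover[OF Suc.prems(1) F(1,2), of v "d + 3"] Suc.prems(2)[of v] by simp
  moreover have "card (E - F) \<le> card E" using Suc.prems(1) by (intro card_mono) auto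
  ultimately have "colourable (E - F) n (d + 2)"
    using Suc.IH[of "E - F"] Suc.prems by auto
  moreover have "\<not> has_path F n"
    using path_length_le_star_forest[of F "{}" n] F(3) n by auto
  ultimately show ?case using colourable_Suc[of F n "E - F" "d + 2" E] by auto
qed

section \<open>The edge bound and the induction on the number of colours\<close>

definition path_bound :: "nat \<Rightarrow> nat \<Rightarrow> real" where
  "path_bound r n =
     (real r + 3) * real r / 4 * real n - real r * (5 * real r + 11) / 4 + 3"

text \<open>The increment is \<open>r + 1\<close> less than \<open>(r + 2) * (n - 3) / 2\<close>,
  and at least that many edges are lost when \<open>n div 2 - 1\<close> vertices of degree at least
  \<open>r + 2\<close> are deleted. Deletion thus pays for the extra colour.\<close>

lemma path_bound_Suc:
  "path_bound (Suc r) n = path_bound r n + ((real r + 2) * (real n - 3) - 2 * real r - 2) / 2"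
  by (simp add: path_bound_def field_simps)

text \<open>Source of the threshold on \<open>n\<close>: for fixed \<open>r\<close> the bound is
  linear in \<open>n\<close>, while the size condition of \<open>colourable_bounded_degree\<close>
  is quadratic.\<close>

lemma six_path_bound_le:
  assumes n: "2 * (r + 3)\<^sup>2 \<le> n"
  shows "6 * path_bound r n \<le> real ((n - 3) * (n - 1))"
proof -
  have "18 \<le> 2 * (r + 3)\<^sup>2" using power_mono[of 3 "r + 3" 2] by simp
  then have n18: "18 \<le> n" using n by linarith
  have nr: "2 * (real r + 3)\<^sup>2 \<le> real n"
    using of_nat_mono[OF n, where 'a = real] by (simp add: add.commute)
  have "6 * path_bound r n \<le> 3 / 2 * ((real r + 3) * real r) * real n + 18"
    by (simp add: path_bound_def)
  also have "\<dots> \<le> 3 / 2 * (real n / 2) * real n - 27 / 2 * real n + 18"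
  proof -
    \<comment> \<open>Here \<open>r * (r + 3) = (r + 3)^2 - 3 * (r + 3)\<close>, with first term at
      most \<open>n / 2\<close> and second at least 9.\<close>
    have "(real r + 3) * real r \<le> real n / 2 - 9"
      using nr by (simp add: power2_eq_square algebra_simps)
    then have "((real r + 3) * real r) * real n \<le> (real n / 2 - 9) * real n"
      by (rule mult_right_mono) simp
    then show ?thesis by (simp add: algebra_simps)
  qed
  also have "\<dots> \<le> (real n - 3) * (real n - 1)"
  proof -
    have "18 * real n \<le> real n * real n" using n18 by (intro mult_right_mono) auto
    moreover have "(real n - 3) * (real n - 1) = real n * real n - 4 * real n + 3"
      by (simp add: algebra_simps)
    moreover have "3 / 2 * (real n / 2) * real n = 3 / 4 * (real n * real n)" by simp
    moreover have "18 \<le> real n" using n18 by simp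
    ultimately show ?thesis by linarith
  qed
  also have "\<dots> = real ((n - 3) * (n - 1))" using n18 by (simp add: of_nat_diff)
  finally show ?thesis .
qed

lemma colourable_two_stuck:
  assumes E: "finite E" and small: "real (card E) < path_bound 2 n" and n: "6 \<le> n"
    and S: "finite S" "card S < n div 2 - 1"
    and H: "H = {e \<in> E. e \<inter> S = {}}" "card H + 3 * card S \<le> card E" "\<And>v. degree H v \<le> 2"
  shows "colourable E n 2"
proof -
  have fin: "finite H" using E H(1) by simp
  have n3: "3 \<le> n" using n by simp
  obtain B where B: "B \<subseteq> H" "card B * (n - 1) \<le> 2 * card H" "\<not> has_path (H - B) n"
    using break_paths[OF fin H(3) n3] by blast
  \<comment> \<open>The size that \<open>B\<close> must reach before the vertex cover bound admits a
    path.\<close>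
  let ?u = "real n - 1 - 2 * real (card S)"
  have "2 * card S + 1 + card B < n"
  proof (rule ccontr)
    assume "\<not> 2 * card S + 1 + card B < n"
    then have "?u \<le> real (card B)" by linarith
    then have "?u * (real n - 1) \<le> real (card B) * (real n - 1)"
      using n by (intro mult_right_mono) auto
    also have "\<dots> = real (card B * (n - 1))" using n by (simp add: of_nat_diff)
    also have "\<dots> \<le> real (2 * card H)" using B(2) of_nat_le_iff by blast
    also have "\<dots> \<le> 2 * real (card E) - 6 * real (card S)" using H(2) by linarith
    also have "\<dots> < 5 * real n - 15 - 6 * real (card S)"
      using small by (simp add: path_bound_def)
    \<comment> \<open>Moving \<open>3 * ?u\<close> to the left leaves
      \<open>?u * (n - 4) < 2 * n - 12\<close>, impossible once \<open>?u\<close> is at least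
      2.\<close>
    also have "\<dots> = 2 * real n - 12 + 3 * ?u" by simp
    finally have *: "?u * (real n - 4) < 2 * real n - 12" by (simp add: algebra_simps)
    have "2 \<le> ?u" using S(2) by linarith
    then have "2 * (real n - 4) \<le> ?u * (real n - 4)" using n by (intro mult_right_mono) auto
    from le_less_trans[OF this *] show False by simp
  qed
  moreover have "finite B" using B(1) fin finite_subset by blast
  ultimately have "\<not> has_path (E - H \<union> B) n"
    using path_length_le_vertex_cover[of "E - H \<union> B" n S B] S(1) by (auto simp: H(1))
  then have "colourable E n (Suc 1)"
    by (rule colourable_Suc[OF _ colourable_one[OF B(3)]]) auto
  then show ?thesis by (simp add: numeral_2_eq_2)
qed

lemma colourable_if_card_less:
  assumes "1 \<le> r" "2 * (r + 3)\<^sup>2 \<le> n" "finite E" "real (card E) < path_bound r n"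
  shows "colourable E n r"
  using assms
proof (induction r arbitrary: E rule: nat_induct_at_least)
  case base
  \<comment> \<open>For one colour the bound is \<open>n - 1\<close>, the number of edges of the
    path.\<close>
  then have "real (card E) < real n - 1" by (simp add: path_bound_def)
  then have "\<not> has_path E n"
    using path_length_le_vertex_cover[of E n "{}" E] base by fastforce
  then show ?case by (rule colourable_one)
next
  case (Suc r)
  have "(r + 3)\<^sup>2 \<le> (Suc r + 3)\<^sup>2" by (rule power_mono) auto
  then have n: "2 * (r + 3)\<^sup>2 \<le> n" using Suc.prems(1) by linarith
  have "18 \<le> 2 * (r + 3)\<^sup>2" using power_mono[of 3 "r + 3" 2] by simp
  then have n18: "18 \<le> n" using n by linarith
  \<comment> \<open>The largest \<open>k\<close> with \<open>2 * k + 1 < n\<close>, so that the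
    edges at \<open>k\<close> vertices contain no path on \<open>n\<close> vertices.\<close>
  let ?k = "n div 2 - 1"
  obtain S where S: "finite S" "card S \<le> ?k"
    "card {e \<in> E. e \<inter> S = {}} + (r + 2) * card S \<le> card E"
    "card S = ?k \<or> (\<forall>v. degree {e \<in> E. e \<inter> S = {}} v < r + 2)"
    using greedy_deletion[OF Suc.prems(2), of "r + 2" ?k] by auto
  define H where "H = {e \<in> E. e \<inter> S = {}}"
  have fin: "finite H" using Suc.prems(2) by (simp add: H_def)
  have E: "E \<subseteq> H \<union> (E - H)" by auto
  have no_path: "\<not> has_path (E - H) n"
  proof
    assume "has_path (E - H) n"
    then have "n \<le> 2 * card S + 1 + card ({} :: 'a set set)"
      using S(1) by (rule path_length_le_vertex_cover) (auto simp: H_def)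
    then show False using S(2) n18 by simp
  qed
  show ?case
  proof (cases "card S = ?k")
    case True
    have "real n - 3 \<le> 2 * real (card S)" using True by linarith
    then have "(real r + 2) * (real n - 3) \<le> (real r + 2) * (2 * real (card S))"
      by (intro mult_left_mono) auto
    moreover have "real (card H) + (real r + 2) * real (card S) \<le> real (card E)"
      using of_nat_mono[OF S(3), where 'a = real] by (simp add: H_def algebra_simps)
    moreover note Suc.prems(3)[unfolded path_bound_Suc] of_nat_0_le_iff[of r, where 'a = real]
    ultimately have "real (card H) < path_bound r n" by argo
    then have "colourable H n r" using Suc.IH n fin by blast
    then show ?thesis using colourable_Suc no_path E by blast
  next
    case False
    then have deg: "degree H v \<le> r + 1" for v
      using S(4) by (auto simp: H_def less_Suc_eq_le)
    show ?thesis
    \<comment> \<open>\<open>colourable_bounded_degree\<close> needs at least two colours for the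
      remainder, so \<open>r = 1\<close> is treated apart.\<close>
    proof (cases "r = 1")
      case True
      then have "colourable E n 2"
        using Suc.prems(2,3) n18 S False deg H_def
        by (intro colourable_two_stuck[of E n S H]) (auto simp: numeral_2_eq_2 numeral_3_eq_3)
      then show ?thesis using True by (simp add: numeral_2_eq_2)
    next
      case False
      then obtain d where d: "r = d + 2" using Suc.hyps that[of "r - 2"] by linarith
      have "6 * real (card E) < real ((n - 3) * (n - 1))"
        using six_path_bound_le[OF Suc.prems(1)] Suc.prems(3) by linarith
      then have "6 * card E < (n - 3) * (n - 1)" by linarith
      moreover have "card H \<le> card E" using Suc.prems(2) by (intro card_mono) (auto simp: H_def)
      ultimately have "6 * card H < (n - 3) * (n - 1)" by linarith
      moreover have "degree H v \<le> d + 3" for v using deg[of v] d by simp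
      ultimately have "colourable H n r"
        unfolding d by (intro colourable_bounded_degree[OF fin])
      then show ?thesis using colourable_Suc no_path E by blast
    qed
  qed
qed

section \<open>Transfer to size-Ramsey numbers\<close>

lemma contains_path_graph_imp_has_path:
  assumes "contains_copy G (path_graph n)"
  shows "has_path (edges G) n"
proof -
  obtain f where f: "inj_on f {..<n}" "\<And>e. e \<in> edges (path_graph n) \<Longrightarrow> f ` e \<in> edges G"
    using assms unfolding contains_copy_def by (auto simp: path_graph_def)
  have "{f i, f (Suc i)} \<in> edges G" if "Suc i < n" for i
    using f(2)[of "{i, Suc i}"] that by (auto simp: path_graph_def)
  then show ?thesis using f(1) unfolding has_path_def by blast
qed

lemma not_ramsey_arrow_if_colourable:
  assumes "colourable (edges G) n r"
  shows "\<not> ramsey_arrow G (path_graph n) r"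
proof
  assume arrow: "ramsey_arrow G (path_graph n) r"
  obtain c where c: "c ` edges G \<subseteq> {..<r}"
    "\<And>k. k < r \<Longrightarrow> \<not> has_path {e \<in> edges G. c e = k} n"
    using assms unfolding colourable_def by blast
  obtain k where "k < r" "contains_copy (colour_class G c k) (path_graph n)"
    using arrow c(1) unfolding ramsey_arrow_def by blast
  then show False
    using c(2) contains_path_graph_imp_has_path[of "colour_class G c k" n]
    by (simp add: colour_class_def)
qed

text \<open>Ensures that the \<open>LEAST\<close> in \<open>size_ramsey\<close> is attained. A large
  complete graph works: it has a monochromatic clique on \<open>n\<close> vertices, and any
  enumeration of a clique traverses a path.\<close>

lemma ex_ramsey_arrow_path_graph:
  "\<exists>G :: nat graph. finite_simple_graph G \<and> ramsey_arrow G (path_graph n) r"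
proof -
  obtain N :: nat where N: "partn_lst {..<N} (replicate r n) 2" using ramsey_full by blast
  define G :: "nat graph" where "G = \<lparr>verts = {..<N}, edges = nsets {..<N} 2\<rparr>"
  have "finite_simple_graph G" by (auto simp: finite_simple_graph_def G_def nsets_def)
  moreover have "ramsey_arrow G (path_graph n) r"
    unfolding ramsey_arrow_def
  proof (intro allI impI)
    fix c :: "nat set \<Rightarrow> nat" assume "c ` edges G \<subseteq> {..<r}"
    then have "c \<in> nsets {..<N} 2 \<rightarrow> {..<length (replicate r n)}" by (auto simp: G_def)
    then obtain k where k: "k < r" "monochromatic {..<N} n 2 c k"
      using N unfolding partn_lst_def by fastforce
    then obtain H where H: "H \<in> nsets {..<N} n" "c ` nsets H 2 \<subseteq> {k}"
      unfolding monochromatic_def by blast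
    then have H': "finite H" "card H = n" "H \<subseteq> {..<N}" by (auto simp: nsets_def)
    then obtain f where f: "bij_betw f {..<n} H"
      using ex_bij_betw_nat_finite by (metis lessThan_atLeast0)
    have "f ` {i, Suc i} \<in> {e \<in> edges G. c e = k}" if "Suc i < n" for i
    proof -
      have "f i \<in> H" "f (Suc i) \<in> H" "f i \<noteq> f (Suc i)"
        using f that by (auto simp: bij_betw_def inj_on_eq_iff)
      then have "f ` {i, Suc i} \<in> nsets H 2" by (auto simp: nsets_def)
      moreover from this have "f ` {i, Suc i} \<in> edges G"
        using H'(3) by (auto simp: nsets_def G_def)
      ultimately show ?thesis using H(2) by blast
    qed
    then have edge: "f ` e \<in> edges (colour_class G c k)" if "e \<in> edges (path_graph n)" for e
      using that by (force simp: path_graph_def colour_class_def)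
    have "inj_on f (verts (path_graph n))" "f ` verts (path_graph n) \<subseteq> verts (colour_class G c k)"
      using f H'(3) by (auto simp: bij_betw_def path_graph_def colour_class_def G_def)
    then have "contains_copy (colour_class G c k) (path_graph n)"
      unfolding contains_copy_def using edge by blast
    then show "\<exists>k<r. contains_copy (colour_class G c k) (path_graph n)" using k(1) by blast
  qed
  ultimately show ?thesis by blast
qed

theorem theorem2p1:
  fixes r :: nat
  assumes "r \<ge> 1"
  shows "\<forall>\<^sub>F n in sequentially.
           real (size_ramsey (path_graph n) r)
             \<ge> (real r + 3) * real r / 4 * real n - real r * (5 * real r + 11) / 4 + 3"
proof (rule eventually_sequentiallyI)
  fix n assume n: "2 * (r + 3)\<^sup>2 \<le> n"
  have "\<exists>m. \<exists>G :: nat graph.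
    finite_simple_graph G \<and> ramsey_arrow G (path_graph n) r \<and> card (edges G) = m"
    using ex_ramsey_arrow_path_graph by blast
  from LeastI_ex[OF this] obtain G :: "nat graph" where G: "finite_simple_graph G"
    "ramsey_arrow G (path_graph n) r" "card (edges G) = size_ramsey (path_graph n) r"
    unfolding size_ramsey_def by blast
  have "edges G \<subseteq> Pow (verts G)" "finite (verts G)"
    using G(1) unfolding finite_simple_graph_def by auto
  then have "finite (edges G)" by (meson finite_Pow_iff finite_subset)
  then have "path_bound r n \<le> real (card (edges G))"
    using colourable_if_card_less[OF assms n] not_ramsey_arrow_if_colourable G(2)
    by (meson not_less)
  then show "real (size_ramsey (path_graph n) r)
      \<ge> (real r + 3) * real r / 4 * real n - real r * (5 * real r + 11) / 4 + 3"
    using G(3) by (simp add: path_bound_def)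
qed

end
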